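(* Let $\mathfrak a_{n,m}$ be the number of $\sigma\in\mathcal{I}_n(101,120)$ with $\max(\sigma)=m$, and let $\mathfrak a'_{n,m}$ be the number of those $\sigma$ which moreover satisfy $\sigma_n=m$. Let $\mathfrak b_{n,k}=\sum_{\ell=0}^{n}|\mathcal W_{\ell,k}(101,120)|$ be the number of words of length at most $n$ over $\{0,\dots,k-1\}$ avoiding both $101$ and $120$. Then for all integers $0<m<n$, $$\mathfrak a_{n,m}=\sum_{p=m+1}^{n}\sum_{j=0}^{m-1}\Big(\mathfrak a'_{p-1,j}\,\mathfrak b_{n-p,m-j}+(\mathfrak a_{p-1,j}-\mathfrak a'_{p-1,j})\,\mathfrak b_{n-p,m-j-1}\Big),$$ $$\mathfrak a'_{n,m}=\sum_{p=m+1}^{n}\sum_{j=0}^{m-1}\mathfrak a_{p-1,j}.$$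
   Context: For $n\in\mathbb N$, an inversion sequence of size $n$ is a sequence $\sigma=(\sigma_1,\dots,\sigma_n)\in\mathbb N^n$ with $\sigma_i<i$ for all $i$. An integer sequence contains a pattern $\rho$ (a finite integer sequence such as $101$ or $120$) if it has a subsequence order-isomorphic to $\rho$, and avoids $\rho$ otherwise. $\mathcal{I}_n(P)$ denotes the set of inversion sequences of size $n$ avoiding every pattern in the set $P$. $\mathcal W_{n,k}=\{0,\dots,k-1\}^n$ is the set of words of length $n$ over $\{0,\dots,k-1\}$, and $\mathcal W_{n,k}(P)$ its subset of words avoiding every pattern in $P$. $\max(\sigma)$ is the largest entry of $\sigma$. *)

theory Defs
  imports Main "HOL-Library.Sublist"
begin

definition order_isomorphic :: "'a::linorder list \<Rightarrow> 'b::linorder list \<Rightarrow> bool" where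
  "order_isomorphic xs ys \<longleftrightarrow>
     length xs = length ys \<and>
     (\<forall>i<length xs. \<forall>j<length xs. xs ! i < xs ! j \<longleftrightarrow> ys ! i < ys ! j)"

(* subseq is the library's relation for not necessarily contiguous subsequences. *)
definition contains_pattern :: "'a::linorder list \<Rightarrow> 'b::linorder list \<Rightarrow> bool" where
  "contains_pattern \<sigma> \<rho> \<longleftrightarrow> (\<exists>\<tau>. subseq \<tau> \<sigma> \<and> order_isomorphic \<tau> \<rho>)"

definition avoids_patterns :: "'a::linorder list \<Rightarrow> 'b::linorder list set \<Rightarrow> bool" where
  "avoids_patterns \<sigma> P \<longleftrightarrow> (\<forall>\<rho>\<in>P. \<not> contains_pattern \<sigma> \<rho>)"

(* Entry i + 1 of the 1-based sequence is \<sigma> ! i, so the bound "entry < index" becomes < Suc i. *)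
definition inversion_sequences :: "nat \<Rightarrow> nat list set" where
  "inversion_sequences n = {\<sigma>. length \<sigma> = n \<and> (\<forall>i<n. \<sigma> ! i < Suc i)}"

definition avoiding_inversion_sequences :: "nat \<Rightarrow> nat list set \<Rightarrow> nat list set" where
  "avoiding_inversion_sequences n P = {\<sigma> \<in> inversion_sequences n. avoids_patterns \<sigma> P}"

definition words :: "nat \<Rightarrow> nat \<Rightarrow> nat list set" where
  "words n k = {w. length w = n \<and> set w \<subseteq> {..<k}}"

definition avoiding_words :: "nat \<Rightarrow> nat \<Rightarrow> nat list set \<Rightarrow> nat list set" where
  "avoiding_words n k P = {w \<in> words n k. avoids_patterns w P}"

definition patterns_101_120 :: "nat list set" where
  "patterns_101_120 = {[1, 0, 1], [1, 2, 0]}"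

(* In the next two definitions n = 0 yields an unspecified value, since Max {} and last [] are
   unspecified; they are meant for n > 0. *)
definition count_max :: "nat \<Rightarrow> nat \<Rightarrow> nat" where
  "count_max n m =
     card {\<sigma> \<in> avoiding_inversion_sequences n patterns_101_120. Max (set \<sigma>) = m}"

definition count_max_last :: "nat \<Rightarrow> nat \<Rightarrow> nat" where
  "count_max_last n m =
     card {\<sigma> \<in> avoiding_inversion_sequences n patterns_101_120. Max (set \<sigma>) = m \<and> last \<sigma> = m}"

definition count_words_upto :: "nat \<Rightarrow> nat \<Rightarrow> nat" where
  "count_words_upto n k = (\<Sum>l=0..n. card (avoiding_words l k patterns_101_120))"

end

theory Submission
  imports Defs
begin

text \<open>
  Let \<open>m\<close> be the maximum of an avoiding sequence and \<open>p\<close> the position of its first occurrence.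
  Avoiding 101 makes the occurrences of \<open>m\<close> contiguous, so the sequence is \<open>\<alpha> m\<dots>m w\<close> with all
  entries of \<open>\<alpha>\<close> and \<open>w\<close> below \<open>m\<close>. Let \<open>j\<close> be the maximum of \<open>\<alpha>\<close>. Avoiding 120 forces every
  entry of \<open>w\<close> to be at least \<open>j\<close>, and by 101 the value \<open>j\<close> itself may reappear in \<open>w\<close> exactly
  when \<open>\<alpha>\<close> ends with \<open>j\<close>. No other condition links \<open>\<alpha>\<close> and \<open>w\<close>: after a shift, \<open>w\<close> is an arbitrary
  avoiding word over \<open>m - j\<close> or \<open>m - j - 1\<close> letters, of any length up to \<open>n - p\<close>.
\<close>

section \<open>Subsequences of concatenations, and the two patterns as concrete triples\<close>

lemma subseq_pair_append_iff:
  "subseq [a, b] (xs @ ys) \<longleftrightarrow>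
     subseq [a, b] xs \<or> (a \<in> set xs \<and> b \<in> set ys) \<or> subseq [a, b] ys" (is "?L \<longleftrightarrow> ?R")
proof
  show "?L \<Longrightarrow> ?R"
    by (auto simp: subseq_append_iff Cons_eq_append_conv subseq_singleton_left)
  show "?R \<Longrightarrow> ?L"
    using list_emb_append_mono[of "(=)" "[a]" xs "[b]" ys]
    by (auto simp: subseq_singleton_left intro: subseq_drop_many subseq_rev_drop_many)
qed

lemma subseq_triple_append_iff:
  "subseq [a, b, c] (xs @ ys) \<longleftrightarrow>
     subseq [a, b, c] xs \<or> (subseq [a, b] xs \<and> c \<in> set ys) \<or>
     (a \<in> set xs \<and> subseq [b, c] ys) \<or> subseq [a, b, c] ys" (is "?L \<longleftrightarrow> ?R")
proof
  show "?L \<Longrightarrow> ?R"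
    by (auto simp: subseq_append_iff Cons_eq_append_conv subseq_singleton_left)
  show "?R \<Longrightarrow> ?L"
    using list_emb_append_mono[of "(=)" "[a]" xs "[b, c]" ys]
      list_emb_append_mono[of "(=)" "[a, b]" xs "[c]" ys]
    by (auto simp: subseq_singleton_left intro: subseq_drop_many subseq_rev_drop_many)
qed

lemma subseq_set_subset: "subseq xs ys \<Longrightarrow> set xs \<subseteq> set ys"
  by (auto simp: subseq_conv_nths dest: in_set_nthsD)

text \<open>Allows the suffix \<open>w\<close> to be shifted down to an alphabet starting at 0: a
  strictly increasing map preserves and reflects \<open><\<close>, and the subsequences of an image
  list are the images of subsequences.\<close>

lemma contains_pattern_map:
  assumes "strict_mono f"
  shows "contains_pattern (map f xs) \<rho> \<longleftrightarrow> contains_pattern xs \<rho>"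
proof -
  have iso: "order_isomorphic (map f \<tau>) \<rho> \<longleftrightarrow> order_isomorphic \<tau> \<rho>" for \<tau>
    using strict_mono_less[OF assms] by (auto simp: order_isomorphic_def)
  have sub: "subseq \<tau> (map f xs) \<longleftrightarrow> (\<exists>\<tau>'. subseq \<tau>' xs \<and> \<tau> = map f \<tau>')" for \<tau>
    by (auto simp: subseq_conv_nths nths_map)
  show ?thesis
    unfolding contains_pattern_def sub using iso by blast
qed

lemma avoids_patterns_map:
  "strict_mono f \<Longrightarrow> avoids_patterns (map f xs) P \<longleftrightarrow> avoids_patterns xs P"
  by (simp add: avoids_patterns_def contains_pattern_map)

lemma avoids_patterns_subseq:
  "avoids_patterns ys P \<Longrightarrow> subseq xs ys \<Longrightarrow> avoids_patterns xs P"
  unfolding avoids_patterns_def contains_pattern_def by (meson subseq_order.order_trans)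

text \<open>Comparing by \<open><\<close> in both orders also fixes ties: neither outer entry is
  below the other, so by linearity they are equal.\<close>

lemma order_isomorphic_101:
  "order_isomorphic \<tau> [1, 0, 1 :: nat] \<longleftrightarrow> (\<exists>a b. \<tau> = [a, b, a] \<and> b < a)" (is "?L \<longleftrightarrow> ?R")
proof
  show "?L \<Longrightarrow> ?R"
    by (auto simp: order_isomorphic_def length_Suc_conv All_less_Suc numeral_2_eq_2)
  show "?R \<Longrightarrow> ?L"
    by (auto simp: order_isomorphic_def less_Suc_eq)
qed

lemma order_isomorphic_120:
  "order_isomorphic \<tau> [1, 2, 0 :: nat] \<longleftrightarrow> (\<exists>a b c. \<tau> = [a, b, c] \<and> c < a \<and> a < b)" (is "?L \<longleftrightarrow> ?R")
proof
  show "?L \<Longrightarrow> ?R"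
    by (auto simp: order_isomorphic_def length_Suc_conv All_less_Suc numeral_2_eq_2)
  show "?R \<Longrightarrow> ?L"
    by (auto simp: order_isomorphic_def less_Suc_eq)
qed

lemma avoids_101_120_iff:
  "avoids_patterns xs patterns_101_120 \<longleftrightarrow>
     (\<forall>a b. b < a \<longrightarrow> \<not> subseq [a, b, a] xs) \<and>
     (\<forall>a b c. c < a \<longrightarrow> a < b \<longrightarrow> \<not> subseq [a, b, c] xs)"
proof -
  have "contains_pattern xs [1, 0, 1 :: nat] \<longleftrightarrow> (\<exists>a b. b < a \<and> subseq [a, b, a] xs)"
    unfolding contains_pattern_def order_isomorphic_101 by metis
  moreover have "contains_pattern xs [1, 2, 0 :: nat] \<longleftrightarrow>
      (\<exists>a b c. c < a \<and> a < b \<and> subseq [a, b, c] xs)"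
    unfolding contains_pattern_def order_isomorphic_120 by metis
  ultimately show ?thesis
    unfolding avoids_patterns_def patterns_101_120_def ball_simps by metis
qed

section \<open>Avoidance across a block of maxima\<close>

text \<open>The smallest value allowed after the block of maxima that follows \<open>\<alpha>\<close>.\<close>
definition suffix_floor :: "nat list \<Rightarrow> nat" where
  "suffix_floor \<alpha> = (if last \<alpha> = Max (set \<alpha>) then Max (set \<alpha>) else Suc (Max (set \<alpha>)))"

lemma Max_le_suffix_floor: "Max (set \<alpha>) \<le> suffix_floor \<alpha>"
  by (simp add: suffix_floor_def)

text \<open>A violated floor exhibits a forbidden triple. Conversely, the floor puts every entry of
  \<open>\<alpha>\<close> weakly below every later entry, so a forbidden triple leaving
  \<open>\<alpha>\<close> could only be a 101 whose outer value is
  \<open>Max (set \<alpha>)\<close>, and then \<open>\<alpha>\<close> already contains one.\<close>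

lemma avoids_append_replicate_append_iff:
  fixes \<alpha> w :: "nat list"
  assumes ne: "\<alpha> \<noteq> []" and \<alpha>: "set \<alpha> \<subseteq> {..<m}" and w: "set w \<subseteq> {..<m}"
  shows "avoids_patterns (\<alpha> @ replicate (Suc c) m @ w) patterns_101_120 \<longleftrightarrow>
     avoids_patterns \<alpha> patterns_101_120 \<and> avoids_patterns w patterns_101_120 \<and>
     set w \<subseteq> {suffix_floor \<alpha>..}"
    (is "?L \<longleftrightarrow> ?R")
proof
  let ?j = "Max (set \<alpha>)" and ?M = "replicate (Suc c) m"
  assume L: ?L
  have jin: "?j \<in> set \<alpha>" using ne by simp
  then have jm: "?j < m" using \<alpha> by auto
  have "suffix_floor \<alpha> \<le> x" if x: "x \<in> set w" for x
  proof (rule ccontr)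
    assume "\<not> suffix_floor \<alpha> \<le> x"
    \<comment> \<open>The two ways to fail: \<open>x\<close> below \<open>?j\<close> yields the 120
      triple \<open>?j\<close>, \<open>m\<close>, \<open>x\<close>; \<open>x\<close> equal to
      \<open>?j\<close>, with the smaller \<open>last \<alpha>\<close> in between, yields a
      101.\<close>
    then consider "x < ?j" | "x = ?j" "last \<alpha> \<noteq> ?j"
      by (fastforce simp: suffix_floor_def split: if_splits)
    then show False
    proof cases
      case 1
      have "subseq [?j, m, x] (\<alpha> @ ?M @ w)"
        using jin x list_emb_append_mono[of "(=)" "[?j]" \<alpha> "[m, x]" "?M @ w"]
        by (simp add: subseq_singleton_left)
      with L 1 jm show False by (auto simp: avoids_101_120_iff)
    next
      case 2
      have "last \<alpha> < ?j" using 2 Max_ge[of "set \<alpha>" "last \<alpha>"] ne by (simp add: order_less_le)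
      \<comment> \<open>The maximum is attained, but not in last position, hence earlier.\<close>
      have "?j \<in> set (butlast \<alpha>)"
        using jin 2 ne by (metis append_butlast_last_id rotate1.simps(2) set_ConsD set_rotate1)
      then have "subseq [?j, last \<alpha>] (butlast \<alpha> @ [last \<alpha>])"
        by (subst subseq_pair_append_iff) simp
      then have "subseq [?j, last \<alpha>] \<alpha>" using ne by simp
      then have "subseq [?j, last \<alpha>, ?j] (\<alpha> @ ?M @ w)"
        using x 2 by (subst subseq_triple_append_iff) simp
      with L \<open>last \<alpha> < ?j\<close> show False by (auto simp: avoids_101_120_iff)
    qed
  qed
  moreover have "subseq w (\<alpha> @ ?M @ w)" "subseq \<alpha> (\<alpha> @ ?M @ w)"
    by (auto intro: subseq_drop_many)
  ultimately show ?R using L avoids_patterns_subseq by blast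
next
  let ?j = "Max (set \<alpha>)" and ?M = "replicate (Suc c) m"
  assume R: ?R
  have le: "a \<le> ?j" if "a \<in> set \<alpha>" for a using that by simp
  have jm: "?j < m" using \<alpha> ne by auto
  have ge: "?j \<le> b" if "b \<in> set (?M @ w)" for b
    using that R jm Max_le_suffix_floor[of \<alpha>] by (fastforce simp del: replicate_Suc)
  have M: "a = m" if "a \<in> set ?M" for a using that by auto
  have mem: "a \<in> set xs" "b \<in> set xs" if "subseq [a, b] xs" for a b and xs :: "nat list"
    using subseq_set_subset[OF that] by auto
  have mem3: "a \<in> set xs" "b \<in> set xs" "c \<in> set xs" if "subseq [a, b, c] xs"
    for a b c and xs :: "nat list"
    using subseq_set_subset[OF that] by auto
  show ?L
    unfolding avoids_101_120_iff
  proof (intro conjI allI impI notI)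
    fix a b assume ba: "b < a" and "subseq [a, b, a] (\<alpha> @ ?M @ w)"
    then consider "subseq [a, b, a] \<alpha>" | "subseq [a, b] \<alpha>" "a \<in> set (?M @ w)"
      | "a \<in> set \<alpha>" "subseq [b, a] (?M @ w)" | "subseq [a, b, a] (?M @ w)"
      unfolding subseq_triple_append_iff[of _ _ _ \<alpha>] by blast
    then show False
    proof cases
      case 1 then show ?thesis using R ba by (auto simp: avoids_101_120_iff)
    next
      case 2
      \<comment> \<open>\<open>a\<close> occurs on both sides of the border, and \<open>?j\<close>
        weakly separates the sides.\<close>
      have a: "a = ?j" using ge[OF 2(2)] le[OF mem(1)[OF 2(1)]] by simp
      then have "a \<noteq> m" using jm by simp
      then have "a \<in> set w" using 2(2) M by (metis Un_iff set_append)
      then have "suffix_floor \<alpha> \<le> a" using R by auto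
      then have la: "last \<alpha> = a" using a by (auto simp: suffix_floor_def split: if_splits)
      have "subseq [a, b] (butlast \<alpha> @ [last \<alpha>])" using 2(1) ne by simp
      \<comment> \<open>\<open>b\<close> differs from \<open>last \<alpha>\<close>, so the pair lies
        before that entry, which then completes a 101 inside \<open>\<alpha>\<close>.\<close>
      then have "subseq [a, b] (butlast \<alpha>)"
        unfolding subseq_pair_append_iff using la ba by auto
      then have "subseq [a, b, a] (butlast \<alpha> @ [last \<alpha>])"
        unfolding subseq_triple_append_iff using la by auto
      then have "subseq [a, b, a] \<alpha>" using ne by simp
      then show ?thesis using R ba by (auto simp: avoids_101_120_iff)
    next
      case 3 then show ?thesis using ge[OF mem(1)[OF 3(2)]] le[OF 3(1)] ba by simp
    next
      case 4
      \<comment> \<open>A 101 starting in the block has \<open>a = m\<close>; its middle entry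
        cannot be \<open>m\<close>, and no \<open>m\<close> is left in \<open>w\<close> to close
        it.\<close>
      then consider "subseq [a, b, a] w" | "a \<in> set ?M" "b \<in> set ?M" | "a \<in> set ?M" "a \<in> set w"
        unfolding subseq_triple_append_iff by (blast dest: mem mem3)
      then show ?thesis
      proof cases
        case 1 then show ?thesis using R ba by (auto simp: avoids_101_120_iff)
      next
        case 2 then show ?thesis using M[OF 2(1)] M[OF 2(2)] ba by simp
      next
        case 3 then show ?thesis using M[OF 3(1)] w by auto
      qed
    qed
  next
    fix a b c' assume ca: "c' < a" and ab: "a < b" and "subseq [a, b, c'] (\<alpha> @ ?M @ w)"
    then consider "subseq [a, b, c'] \<alpha>" | "a \<in> set \<alpha>" "c' \<in> set (?M @ w)"
      | "subseq [a, b, c'] (?M @ w)"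
      unfolding subseq_triple_append_iff[of _ _ _ \<alpha>] by (blast dest: mem)
    then show False
    proof cases
      case 1 then show ?thesis using R ab ca by (auto simp: avoids_101_120_iff)
    next
      case 2 then show ?thesis using ge[OF 2(2)] le[OF 2(1)] ca by simp
    next
      case 3
      \<comment> \<open>A 120 starting in the block would need an entry above
        \<open>m\<close>.\<close>
      then consider "subseq [a, b, c'] w" | "a \<in> set ?M" "b \<in> set ?M \<union> set w"
        unfolding subseq_triple_append_iff by (blast dest: mem mem3)
      then show ?thesis
      proof cases
        case 1 then show ?thesis using R ab ca by (auto simp: avoids_101_120_iff)
      next
        case 2
        then have "b \<le> m" using M w by (metis Un_iff lessThan_iff less_imp_le order_refl subsetD)
        then show ?thesis using M[OF 2(1)] ab by simp
      qed
    qed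
  qed
qed

text \<open>The block starts at the first \<open>m\<close>. If \<open>m\<close> came back after it,
  the first entry behind the block would lie between two copies of \<open>m\<close> and complete a
  101.\<close>

lemma avoids_split_at_max:
  fixes \<sigma> :: "nat list"
  assumes av: "avoids_patterns \<sigma> patterns_101_120" and "m \<in> set \<sigma>" and le: "set \<sigma> \<subseteq> {..m}"
  obtains \<alpha> c w where "\<sigma> = \<alpha> @ replicate (Suc c) m @ w"
    and "set \<alpha> \<subseteq> {..<m}" and "set w \<subseteq> {..<m}"
proof -
  obtain \<alpha> zs where \<sigma>: "\<sigma> = \<alpha> @ m # zs" and \<alpha>: "m \<notin> set \<alpha>"
    using split_list_first[OF \<open>m \<in> set \<sigma>\<close>] by auto
  define w where "w = dropWhile (\<lambda>x. x = m) zs"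
  define c where "c = length (takeWhile (\<lambda>x. x = m) zs)"
  have "takeWhile (\<lambda>x. x = m) zs = replicate c m"
    by (intro replicate_eqI) (auto simp: c_def dest: set_takeWhileD)
  then have zs: "zs = replicate c m @ w"
    by (metis takeWhile_dropWhile_id w_def)
  have "m \<notin> set w"
  proof
    assume m: "m \<in> set w"
    then have ne: "w \<noteq> []" by auto
    have hd: "hd w \<noteq> m" using hd_dropWhile[of "\<lambda>x. x = m" zs] ne by (simp add: w_def)
    then have "m \<in> set (tl w)" using m ne by (metis list.collapse set_ConsD)
    then have "subseq [hd w, m] w" using ne
      by (cases w) (auto simp: subseq_singleton_left)
    then have "subseq [m, hd w, m] \<sigma>"
      unfolding \<sigma> zs by (auto intro: subseq_drop_many)
    moreover have "hd w < m" using hd le ne unfolding \<sigma> zs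
      by (metis Un_iff atMost_iff hd_in_set list.set_intros(2) order_le_less set_append subsetD)
    ultimately show False using av by (auto simp: avoids_101_120_iff)
  qed
  have below: "set xs \<subseteq> {..<m}" if "m \<notin> set xs" "set xs \<subseteq> {..m}" for xs
    using that by (metis atMost_iff lessThan_iff order_le_less subset_iff)
  have "set \<alpha> \<subseteq> {..m}" "set w \<subseteq> {..m}" using le unfolding \<sigma> zs by simp_all
  then have "set \<alpha> \<subseteq> {..<m}" "set w \<subseteq> {..<m}"
    using below \<alpha> \<open>m \<notin> set w\<close> by blast+
  moreover have "\<sigma> = \<alpha> @ replicate (Suc c) m @ w" by (simp add: \<sigma> zs)
  ultimately show ?thesis by (intro that)
qed

text \<open>Since \<open>m\<close> is absent from the outer parts, reading up to the first
  \<open>m\<close> from either end recovers them; the block length is then forced.\<close>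

lemma append_replicate_append_inject:
  assumes "m \<notin> set \<alpha>" "m \<notin> set w" "m \<notin> set \<alpha>'" "m \<notin> set w'"
    and eq: "\<alpha> @ replicate (Suc c) m @ w = \<alpha>' @ replicate (Suc c') m @ w'"
  shows "\<alpha> = \<alpha>' \<and> c = c' \<and> w = w'"
proof -
  have *: "takeWhile (\<lambda>x. x \<noteq> m) (\<beta> @ replicate (Suc d) m @ v) = \<beta>"
    "rev (takeWhile (\<lambda>x. x \<noteq> m) (rev (\<beta> @ replicate (Suc d) m @ v))) = v"
    if "m \<notin> set \<beta>" "m \<notin> set v" for \<beta> v d
    using that by (simp_all add: takeWhile_append flip: replicate_append_same)
  have "\<alpha> = \<alpha>'" "w = w'" using * assms by metis+
  with eq show ?thesis by simp
qed

section \<open>Sequences with prescribed maximum and their decomposition\<close>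

definition avoiding_max :: "nat \<Rightarrow> nat \<Rightarrow> nat list set" where
  "avoiding_max n m =
     {\<sigma> \<in> avoiding_inversion_sequences n patterns_101_120. Max (set \<sigma>) = m}"

lemma finite_words: "finite (words n k)"
  using finite_lists_length_eq[of "{..<k}" n] by (simp add: words_def conj_commute)

lemma finite_avoiding_max: "finite (avoiding_max n m)"
proof (rule finite_subset)
  show "avoiding_max n m \<subseteq> words n n"
    by (force simp: avoiding_max_def avoiding_inversion_sequences_def inversion_sequences_def
        words_def in_set_conv_nth)
qed (rule finite_words)

text \<open>From position \<open>p\<close> on, the bound on entries is automatic, because values up
  to \<open>m\<close> are below \<open>p\<close>.\<close>

lemma inversion_append_iff:
  assumes "length \<alpha> = p - 1" "m < p" "set \<beta> \<subseteq> {..m}"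
  shows "\<alpha> @ \<beta> \<in> inversion_sequences n \<longleftrightarrow>
    \<alpha> \<in> inversion_sequences (p - 1) \<and> p - 1 + length \<beta> = n"
proof -
  have "\<beta> ! i \<le> i + (p - 1)" if "i < length \<beta>" for i
    using nth_mem[OF that] assms by fastforce
  then show ?thesis
    using assms(1)
    by (auto simp: inversion_sequences_def nth_append less_Suc_eq_le)
      (metis add.commute le_add_diff_inverse2 nat_add_left_cancel_less not_less)+
qed

text \<open>Joins the criteria for entry bounds and for patterns. In the length equation,
  \<open>p\<close> already counts the first \<open>m\<close>, so \<open>c\<close> counts the further
  copies.\<close>

lemma extension_in_avoiding_max_iff:
  assumes "\<alpha> \<noteq> []" "length \<alpha> = p - 1" "m < p" and \<alpha>: "set \<alpha> \<subseteq> {..<m}" and w: "set w \<subseteq> {..<m}"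
  shows "\<alpha> @ replicate (Suc c) m @ w \<in> avoiding_max n m \<longleftrightarrow>
    \<alpha> \<in> avoiding_max (p - 1) (Max (set \<alpha>)) \<and> avoids_patterns w patterns_101_120 \<and>
    set w \<subseteq> {suffix_floor \<alpha>..} \<and> p + c + length w = n"
proof -
  have "Max (set (\<alpha> @ replicate (Suc c) m @ w)) = m"
    using \<alpha> w by (intro Max_eqI) auto
  moreover have "set (replicate (Suc c) m @ w) \<subseteq> {..m}" using w by auto
  ultimately show ?thesis
    using inversion_append_iff[OF assms(2,3), of "replicate (Suc c) m @ w" n]
      avoids_append_replicate_append_iff[OF assms(1) \<alpha> w, of c] \<open>m < p\<close>
    by (auto simp: avoiding_max_def avoiding_inversion_sequences_def)
qed

lemma avoiding_max_below:
  assumes "\<alpha> \<in> avoiding_max q j" "j < m" "0 < q"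
  shows "\<alpha> \<noteq> []" "length \<alpha> = q" "Max (set \<alpha>) = j" "set \<alpha> \<subseteq> {..<m}"
proof -
  show len: "length \<alpha> = q" and Max: "Max (set \<alpha>) = j"
    using assms(1)
    by (simp_all add: avoiding_max_def avoiding_inversion_sequences_def inversion_sequences_def)
  show "\<alpha> \<noteq> []" using len \<open>0 < q\<close> by auto
  show "set \<alpha> \<subseteq> {..<m}"
  proof
    fix x assume "x \<in> set \<alpha>"
    then have "x \<le> j" unfolding Max[symmetric] by simp
    with \<open>j < m\<close> show "x \<in> {..<m}" by simp
  qed
qed

text \<open>Supplies surjectivity for both bijections below.\<close>

lemma avoiding_max_cases:
  assumes "0 < m" "m < n" and \<sigma>: "\<sigma> \<in> avoiding_max n m"
  obtains p j \<alpha> c w where "p \<in> {m+1..n}" "j \<in> {0..m-1}" "\<alpha> \<in> avoiding_max (p - 1) j"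
    "\<sigma> = \<alpha> @ replicate (Suc c) m @ w" "set w \<subseteq> {..<m}"
    "avoids_patterns w patterns_101_120" "set w \<subseteq> {suffix_floor \<alpha>..}" "p + c + length w = n"
proof -
  have av: "avoids_patterns \<sigma> patterns_101_120" and len: "length \<sigma> = n"
    and lt: "\<And>i. i < n \<Longrightarrow> \<sigma> ! i < Suc i" and Max: "Max (set \<sigma>) = m"
    using \<sigma> by (auto simp: avoiding_max_def avoiding_inversion_sequences_def inversion_sequences_def)
  have "\<sigma> \<noteq> []" using len assms by auto
  then have "m \<in> set \<sigma>" "set \<sigma> \<subseteq> {..m}" using Max Max_in[of "set \<sigma>"] Max_ge[of "set \<sigma>"] by auto
  then obtain \<alpha> c w where eq: "\<sigma> = \<alpha> @ replicate (Suc c) m @ w"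
    and \<alpha>: "set \<alpha> \<subseteq> {..<m}" and w: "set w \<subseteq> {..<m}"
    using avoids_split_at_max[OF av] by blast
  define p where "p = Suc (length \<alpha>)"
  \<comment> \<open>The first \<open>m\<close> has 0-based index \<open>length \<alpha>\<close>, so
    its bound reads \<open>m < p\<close>. With \<open>0 < m\<close> this makes
    \<open>\<alpha>\<close> nonempty and \<open>Max (set \<alpha>)\<close> meaningful.\<close>
  have "\<sigma> ! length \<alpha> < Suc (length \<alpha>)" by (rule lt) (simp add: eq flip: len)
  then have p: "m < p" by (simp add: eq p_def nth_append)
  then have ne: "\<alpha> \<noteq> []" using assms by (auto simp: p_def)
  have *: "\<alpha> \<in> avoiding_max (p - 1) (Max (set \<alpha>)) \<and> avoids_patterns w patterns_101_120 \<and>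
    set w \<subseteq> {suffix_floor \<alpha>..} \<and> p + c + length w = n"
    using extension_in_avoiding_max_iff[OF ne _ p \<alpha> w, of c n] \<sigma> eq by (simp add: p_def)
  have "Max (set \<alpha>) < m" using ne \<alpha> by auto
  then have "Max (set \<alpha>) \<in> {0..m-1}" using \<open>0 < m\<close> by auto
  with * p eq w show ?thesis by (intro that[of p "Max (set \<alpha>)" \<alpha> c w]) auto
qed

section \<open>Counting by bijections\<close>

text \<open>A sequence is encoded by \<open>(p, j, \<alpha>, l, w)\<close>, with \<open>w\<close>
  the suffix shifted down by the floor and \<open>l\<close> its length; summing over
  \<open>l\<close> gives \<open>count_words_upto\<close>. If the floor equals \<open>m\<close>, the
  alphabet is empty and only the empty word remains.\<close>

lemma card_avoiding_max:
  assumes "0 < m" "m < n"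
  shows "card (avoiding_max n m) =
    (\<Sum>p=m+1..n. \<Sum>j=0..m-1. \<Sum>\<alpha>\<in>avoiding_max (p - 1) j.
       count_words_upto (n - p) (m - suffix_floor \<alpha>))"
proof -
  let ?W = "\<lambda>l \<alpha>. avoiding_words l (m - suffix_floor \<alpha>) patterns_101_120"
  define D where "D = (SIGMA p:{m+1..n}. SIGMA j:{0..m-1}. SIGMA \<alpha>:avoiding_max (p - 1) j.
    SIGMA l:{0..n-p}. ?W l \<alpha>)"
  \<comment> \<open>The lengths \<open>p - 1\<close>, \<open>Suc (n - p - l)\<close> and
    \<open>l\<close> add up to \<open>n\<close>.\<close>
  define f where "f = (\<lambda>(p, j :: nat, \<alpha>, l, w).
    \<alpha> @ replicate (Suc (n - p - l)) m @ map ((+) (suffix_floor \<alpha>)) w)"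
  have mono: "strict_mono ((+) (k :: nat))" for k by (simp add: strict_mono_def)
  have D: "\<alpha> \<noteq> []" "length \<alpha> = p - 1" "m < p" "Max (set \<alpha>) = j" "set \<alpha> \<subseteq> {..<m}"
      "set (map ((+) (suffix_floor \<alpha>)) w) \<subseteq> {..<m}" "length w = l" "l \<le> n - p" "p \<le> n"
      "\<alpha> \<in> avoiding_max (p - 1) j" "avoids_patterns w patterns_101_120"
    if "(p, j, \<alpha>, l, w) \<in> D" for p j \<alpha> l w
  proof -
    have mem: "\<alpha> \<in> avoiding_max (p - 1) j" and "p \<in> {m+1..n}" "j \<in> {0..m-1}"
      using that by (simp_all add: D_def)
    then have "j < m" "0 < p - 1" using \<open>0 < m\<close> by auto
    note below = avoiding_max_below[OF mem this]
    show "\<alpha> \<noteq> []" "length \<alpha> = p - 1" "Max (set \<alpha>) = j" "set \<alpha> \<subseteq> {..<m}" by (fact below)+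
    show "set (map ((+) (suffix_floor \<alpha>)) w) \<subseteq> {..<m}" "length w = l" "l \<le> n - p" "m < p" "p \<le> n"
      "\<alpha> \<in> avoiding_max (p - 1) j" "avoids_patterns w patterns_101_120"
      using that by (auto simp: D_def avoiding_words_def words_def)
  qed
  have "bij_betw f D (avoiding_max n m)"
    unfolding bij_betw_def
  proof
    show "inj_on f D"
    proof (rule inj_onI)
      fix x y assume xy: "x \<in> D" "y \<in> D" "f x = f y"
      obtain p j \<alpha> l w where x: "x = (p, j, \<alpha>, l, w)" by (cases x)
      obtain p' j' \<alpha>' l' w' where y: "y = (p', j', \<alpha>', l', w')" by (cases y)
      have 1: "(p, j, \<alpha>, l, w) \<in> D" and 2: "(p', j', \<alpha>', l', w') \<in> D"
        using xy x y by auto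
      have eq: "\<alpha> @ replicate (Suc (n - p - l)) m @ map ((+) (suffix_floor \<alpha>)) w =
        \<alpha>' @ replicate (Suc (n - p' - l')) m @ map ((+) (suffix_floor \<alpha>')) w'"
        using xy(3) unfolding x y f_def prod.case .
      have "\<alpha> = \<alpha>' \<and> n - p - l = n - p' - l' \<and>
        map ((+) (suffix_floor \<alpha>)) w = map ((+) (suffix_floor \<alpha>')) w'"
        by (rule append_replicate_append_inject[OF _ _ _ _ eq]) (use D(5,6)[OF 1] D(5,6)[OF 2] in fastforce)+
      \<comment> \<open>Equal prefixes have equal floors, and shifting by a fixed floor is
        injective. The remaining components are read off from \<open>\<alpha>\<close> and
        \<open>w\<close>.\<close>
      moreover from this have "w = w'"
        using strict_mono_imp_inj_on[OF mono] inj_map_eq_map by metis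
      ultimately show "x = y"
        unfolding x y using D(2-4,7)[OF 1] D(2-4,7)[OF 2] by auto
    qed
    show "f ` D = avoiding_max n m"
    proof (intro subset_antisym subsetI)
      fix \<sigma> assume "\<sigma> \<in> f ` D"
      then obtain p j \<alpha> l w where mem: "(p, j, \<alpha>, l, w) \<in> D" and \<sigma>: "\<sigma> = f (p, j, \<alpha>, l, w)"
        by auto
      note d = D[OF mem]
      show "\<sigma> \<in> avoiding_max n m"
        unfolding \<sigma> f_def prod.case extension_in_avoiding_max_iff[OF d(1-3,5,6)]
        using d by (auto simp: avoids_patterns_map[OF mono])
    next
      fix \<sigma> assume "\<sigma> \<in> avoiding_max n m"
      then obtain p j \<alpha> c w where *: "p \<in> {m+1..n}" "j \<in> {0..m-1}" "\<alpha> \<in> avoiding_max (p - 1) j"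
        "\<sigma> = \<alpha> @ replicate (Suc c) m @ w" "set w \<subseteq> {..<m}"
        "avoids_patterns w patterns_101_120" "set w \<subseteq> {suffix_floor \<alpha>..}" "p + c + length w = n"
        using avoiding_max_cases[OF assms] by metis
      \<comment> \<open>Truncated subtraction is exact here, since all entries of \<open>w\<close>
        are at least the floor.\<close>
      define v where "v = map (\<lambda>x. x - suffix_floor \<alpha>) w"
      have w: "w = map ((+) (suffix_floor \<alpha>)) v"
        using *(7) by (force simp: v_def intro!: map_idI[symmetric])
      have "v \<in> ?W (length w) \<alpha>"
        using *(5,6,7) by (auto simp: avoiding_words_def words_def w avoids_patterns_map[OF mono])
      then have "(p, j, \<alpha>, length w, v) \<in> D"
        using * by (auto simp: D_def)
      moreover have "f (p, j, \<alpha>, length w, v) = \<sigma>"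
        using *(4,8) w by (auto simp: f_def)
      ultimately show "\<sigma> \<in> f ` D" by blast
    qed
  qed
  then have "card (avoiding_max n m) = card D" by (rule bij_betw_same_card[symmetric])
  also have "\<dots> = (\<Sum>p=m+1..n. \<Sum>j=0..m-1. \<Sum>\<alpha>\<in>avoiding_max (p - 1) j. \<Sum>l=0..n-p. card (?W l \<alpha>))"
    by (simp add: D_def card_SigmaI finite_avoiding_max avoiding_words_def finite_words)
  finally show ?thesis by (simp add: count_words_upto_def)
qed

text \<open>Ending in \<open>m\<close> means that the suffix is empty, so \<open>p\<close> and
  \<open>\<alpha>\<close> determine the sequence and no word factor appears.\<close>

lemma card_avoiding_max_last:
  assumes "0 < m" "m < n"
  shows "card {\<sigma> \<in> avoiding_max n m. last \<sigma> = m} =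
    (\<Sum>p=m+1..n. \<Sum>j=0..m-1. card (avoiding_max (p - 1) j))"
proof -
  define D where "D = (SIGMA p:{m+1..n}. SIGMA j:{0..m-1}. avoiding_max (p - 1) j)"
  \<comment> \<open>The trailing \<open>[]\<close> is the empty suffix, kept so that the general
    injectivity and extension lemmas match.\<close>
  define f where "f = (\<lambda>(p, j :: nat, \<alpha>). \<alpha> @ replicate (Suc (n - p)) m @ [])"
  have D: "\<alpha> \<noteq> []" "length \<alpha> = p - 1" "m < p" "Max (set \<alpha>) = j" "set \<alpha> \<subseteq> {..<m}"
      "p \<le> n" "\<alpha> \<in> avoiding_max (p - 1) j"
    if "(p, j, \<alpha>) \<in> D" for p j \<alpha>
  proof -
    show mem: "\<alpha> \<in> avoiding_max (p - 1) j" and p: "m < p" "p \<le> n"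
      using that by (simp_all add: D_def)
    have "j < m" "0 < p - 1" using that \<open>0 < m\<close> by (auto simp: D_def)
    note below = avoiding_max_below[OF mem this]
    show "\<alpha> \<noteq> []" "length \<alpha> = p - 1" "Max (set \<alpha>) = j" "set \<alpha> \<subseteq> {..<m}" by (fact below)+
  qed
  have "bij_betw f D {\<sigma> \<in> avoiding_max n m. last \<sigma> = m}"
    unfolding bij_betw_def
  proof
    show "inj_on f D"
    proof (rule inj_onI)
      fix x y assume xy: "x \<in> D" "y \<in> D" "f x = f y"
      obtain p j \<alpha> where x: "x = (p, j, \<alpha>)" by (cases x)
      obtain p' j' \<alpha>' where y: "y = (p', j', \<alpha>')" by (cases y)
      have 1: "(p, j, \<alpha>) \<in> D" and 2: "(p', j', \<alpha>') \<in> D" using xy x y by auto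
      have eq: "\<alpha> @ replicate (Suc (n - p)) m @ [] = \<alpha>' @ replicate (Suc (n - p')) m @ []"
        using xy(3) unfolding x y f_def prod.case .
      have "\<alpha> = \<alpha>' \<and> n - p = n - p' \<and> ([] :: nat list) = []"
        by (rule append_replicate_append_inject[OF _ _ _ _ eq]) (use D(5)[OF 1] D(5)[OF 2] in auto)
      then show "x = y"
        unfolding x y using D(2-4)[OF 1] D(2-4)[OF 2] by auto
    qed
    show "f ` D = {\<sigma> \<in> avoiding_max n m. last \<sigma> = m}"
    proof (intro subset_antisym subsetI)
      fix \<sigma> assume "\<sigma> \<in> f ` D"
      then obtain p j \<alpha> where mem: "(p, j, \<alpha>) \<in> D" and \<sigma>: "\<sigma> = f (p, j, \<alpha>)" by auto
      note d = D[OF mem]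
      have "\<sigma> \<in> avoiding_max n m"
        unfolding \<sigma> f_def prod.case
        by (subst extension_in_avoiding_max_iff[OF d(1-3,5)]) (use d in \<open>auto simp: avoids_101_120_iff\<close>)
      moreover have "last \<sigma> = m" by (simp add: \<sigma> f_def last_replicate del: replicate_Suc)
      ultimately show "\<sigma> \<in> {\<sigma> \<in> avoiding_max n m. last \<sigma> = m}" by simp
    next
      fix \<sigma> assume \<sigma>: "\<sigma> \<in> {\<sigma> \<in> avoiding_max n m. last \<sigma> = m}"
      then obtain p j \<alpha> c w where *: "p \<in> {m+1..n}" "j \<in> {0..m-1}" "\<alpha> \<in> avoiding_max (p - 1) j"
        "\<sigma> = \<alpha> @ replicate (Suc c) m @ w" "set w \<subseteq> {..<m}" "p + c + length w = n"
        using avoiding_max_cases[OF assms] by (metis (lifting) mem_Collect_eq)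
      \<comment> \<open>A nonempty \<open>w\<close> would supply the last entry, which is below
        \<open>m\<close>.\<close>
      have "w = []" using \<sigma> *(4,5) last_in_set[of w] by (cases "w = []") auto
      then have "\<sigma> = f (p, j, \<alpha>)" using *(4,6) by (auto simp: f_def)
      moreover have "(p, j, \<alpha>) \<in> D" using * by (auto simp: D_def)
      ultimately show "\<sigma> \<in> f ` D" by blast
    qed
  qed
  then have "card {\<sigma> \<in> avoiding_max n m. last \<sigma> = m} = card D"
    by (rule bij_betw_same_card[symmetric])
  then show ?thesis by (simp add: D_def card_SigmaI finite_avoiding_max)
qed

section \<open>Assembling the recurrences\<close>

lemma count_max_eq: "count_max n m = card (avoiding_max n m)"
  by (simp add: count_max_def avoiding_max_def)

lemma count_max_last_eq: "count_max_last n m = card {\<sigma> \<in> avoiding_max n m. last \<sigma> = m}"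
  by (simp add: count_max_last_def avoiding_max_def conj_assoc)

text \<open>The prefixes are split by whether they end with their maximum \<open>j\<close>; the
  floor is \<open>j\<close> if they do and \<open>Suc j\<close> otherwise.\<close>

lemma sum_suffix_floor:
  "(\<Sum>\<alpha>\<in>avoiding_max q j. int (count_words_upto l (m - suffix_floor \<alpha>))) =
     int (count_max_last q j) * int (count_words_upto l (m - j)) +
     (int (count_max q j) - int (count_max_last q j)) * int (count_words_upto l (m - j - 1))"
proof -
  let ?A = "avoiding_max q j" and ?L = "{\<alpha> \<in> avoiding_max q j. last \<alpha> = j}"
  have L: "?L \<subseteq> ?A" by blast
  have "(\<Sum>\<alpha>\<in>?A. int (count_words_upto l (m - suffix_floor \<alpha>))) =
      (\<Sum>\<alpha>\<in>?A - ?L. int (count_words_upto l (m - suffix_floor \<alpha>))) + (\<Sum>\<alpha>\<in>?L. int (count_words_upto l (m - suffix_floor \<alpha>)))"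
    by (rule sum.subset_diff[OF L finite_avoiding_max])
  also have "(\<Sum>\<alpha>\<in>?A - ?L. int (count_words_upto l (m - suffix_floor \<alpha>))) = (\<Sum>\<alpha>\<in>?A - ?L. int (count_words_upto l (m - j - 1)))"
    by (rule sum.cong) (auto simp: suffix_floor_def avoiding_max_def)
  also have "(\<Sum>\<alpha>\<in>?L. int (count_words_upto l (m - suffix_floor \<alpha>))) = (\<Sum>\<alpha>\<in>?L. int (count_words_upto l (m - j)))"
    by (rule sum.cong) (auto simp: suffix_floor_def avoiding_max_def)
  finally show ?thesis
    \<comment> \<open>The inclusion of \<open>?L\<close> in \<open>?A\<close> turns the integer
      difference of the counts into the cardinality of \<open>?A - ?L\<close>.\<close>
    using card_mono[OF finite_avoiding_max L] card_Diff_subset[OF _ L] finite_avoiding_max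
    by (simp add: count_max_eq count_max_last_eq finite_subset[OF L] of_nat_diff algebra_simps)
qed

theorem theorem16:
  fixes n m :: nat
  assumes "0 < m" and "m < n"
  shows "int (count_max n m) =
           (\<Sum>p=m+1..n. \<Sum>j=0..m-1.
              int (count_max_last (p - 1) j) * int (count_words_upto (n - p) (m - j)) +
              (int (count_max (p - 1) j) - int (count_max_last (p - 1) j)) *
                int (count_words_upto (n - p) (m - j - 1)))
       \<and> count_max_last n m = (\<Sum>p=m+1..n. \<Sum>j=0..m-1. count_max (p - 1) j)"
proof
  have "int (count_max n m) = (\<Sum>p=m+1..n. \<Sum>j=0..m-1. \<Sum>\<alpha>\<in>avoiding_max (p - 1) j.
      int (count_words_upto (n - p) (m - suffix_floor \<alpha>)))"
    unfolding count_max_eq card_avoiding_max[OF assms] of_nat_sum ..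
  then show "int (count_max n m) =
           (\<Sum>p=m+1..n. \<Sum>j=0..m-1.
              int (count_max_last (p - 1) j) * int (count_words_upto (n - p) (m - j)) +
              (int (count_max (p - 1) j) - int (count_max_last (p - 1) j)) *
                int (count_words_upto (n - p) (m - j - 1)))"
    unfolding sum_suffix_floor .
  show "count_max_last n m = (\<Sum>p=m+1..n. \<Sum>j=0..m-1. count_max (p - 1) j)"
    unfolding count_max_eq count_max_last_eq by (rule card_avoiding_max_last[OF assms])
qed

end
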